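(* For every $a\in\mathbb{C}$ with $\tfrac32-4a\notin\{0,-1,-2,\dots\}$, $$F\!\left(a,a+\tfrac12;\tfrac32-4a;\tfrac15\right)=\frac{5^{6a}\,\Gamma(\tfrac45)\,\Gamma(\tfrac65)\,\Gamma(\tfrac32-4a)}{2^{10a}\,\Gamma(\tfrac32)\,\Gamma(\tfrac45-2a)\,\Gamma(\tfrac65-2a)}.$$
   Context: $F(a,b;c;x)=\sum_{n\ge0}\frac{(a,n)(b,n)}{(c,n)(1,n)}x^n$ with $(\alpha,n)=\Gamma(\alpha+n)/\Gamma(\alpha)$ is the Gauss hypergeometric series. $1/\Gamma$ is interpreted as $0$ at the poles of $\Gamma$. *)

theory Defs
  imports "HOL-Analysis.Analysis"
begin

text \<open>
  The symbol \<open>(\<alpha>,n) = \<Gamma>(\<alpha>+n)/\<Gamma>(\<alpha>)\<close> is \<^const>\<open>pochhammer\<close>: by \<open>pochhammer_Gamma\<close> the two agree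
  whenever \<open>\<alpha>\<close> is not a pole of \<open>\<Gamma>\<close>, and at a pole \<^const>\<open>pochhammer\<close> is the limiting value
  \<open>\<alpha>(\<alpha>+1)\<cdots>(\<alpha>+n-1)\<close> of the quotient, so that the series terminates.
\<close>

definition hypergeo_F :: "complex \<Rightarrow> complex \<Rightarrow> complex \<Rightarrow> complex \<Rightarrow> complex" where
  "hypergeo_F a b c x =
     (\<Sum>n. pochhammer a n * pochhammer b n / (pochhammer c n * pochhammer 1 n) * x ^ n)"

lemma hypergeo_F_eq_eval_fps: "hypergeo_F a b c x = eval_fps (fps_hypergeo [a, b] [c] 1) x"
  by (simp add: hypergeo_F_def eval_fps_def pochhammer_fact [symmetric])

lemma hypergeo_F_summable:
  fixes a b c x :: complex
  assumes x: "norm x < 1"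
  shows "summable (\<lambda>n. pochhammer a n * pochhammer b n / (pochhammer c n * pochhammer 1 n) * x ^ n)"
    (is "summable ?f")
proof -
  define r where "r n = (a / of_nat n + 1) * (b / of_nat n + 1) /
    ((c / of_nat n + 1) * (1 / of_nat n + 1)) * x" for n
  have "r \<longlonglongrightarrow> (0 + 1) * (0 + 1) / ((0 + 1) * (0 + 1)) * x"
    unfolding r_def by (intro tendsto_intros lim_const_over_n) auto
  then have "(\<lambda>n. norm (r n)) \<longlonglongrightarrow> norm x"
    using tendsto_norm by fastforce
  moreover have "norm x < (norm x + 1) / 2"
    using x by simp
  ultimately have "eventually (\<lambda>n. norm (r n) < (norm x + 1) / 2) sequentially"
    by (rule order_tendstoD)
  then have "eventually (\<lambda>n. norm (?f (Suc n)) \<le> (norm x + 1) / 2 * norm (?f n)) sequentially"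
    using eventually_gt_at_top[of 0]
  proof eventually_elim
    case (elim n)
    have n: "(of_nat n :: complex) \<noteq> 0"
      using elim by simp
    have "r n = (a + of_nat n) * (b + of_nat n) / ((c + of_nat n) * (1 + of_nat n)) * x"
    proof -
      have *: "u / of_nat n + 1 = (u + of_nat n) / of_nat n" for u :: complex
        using n by (simp add: field_simps)
      show ?thesis
        unfolding r_def * using n by simp
    qed
    then have "?f (Suc n) = r n * ?f n"
      by (simp add: pochhammer_Suc mult_ac)
    then have "norm (?f (Suc n)) = norm (r n) * norm (?f n)"
      by (simp only: norm_mult)
    also have "\<dots> \<le> (norm x + 1) / 2 * norm (?f n)"
      using elim by (intro mult_right_mono) auto
    finally show ?case .
  qed
  then obtain N where "\<And>n. n \<ge> N \<Longrightarrow> norm (?f (Suc n)) \<le> (norm x + 1) / 2 * norm (?f n)"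
    unfolding eventually_sequentially by blast
  then show ?thesis
    using x by (intro summable_ratio_test[of "(norm x + 1) / 2" N]) auto
qed

end

theory Submission
  imports Defs "HOL-Complex_Analysis.Complex_Analysis" "HOL-Real_Asymp.Real_Asymp"
begin

text \<open>
  Put \<open>s = - 2 * a\<close> and, for \<open>e = 0\<close> and \<open>e = 1\<close>, let \<open>I\<^sub>e(s)\<close> be the integral of
  \<open>((1 - 5 * y\<^sup>2)\<^sup>2 * (1 + e * y)) powr s\<close> between the zeros \<open>\<plusminus>sqrt (1/5)\<close> of the first factor.
  Expanding \<open>(1 + y) powr s\<close> by the binomial series and integrating term by term shows that the
  hypergeometric series equals \<open>I\<^sub>1(s) / I\<^sub>0(s)\<close> for real \<open>s > 0\<close>
  (\<open>hypergeometric_sums\<close>).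

  The point of the argument \<open>1/5\<close> is that \<open>I\<^sub>1\<close> satisfies a first-order recurrence:
  \<open>I\<^sub>1(s + 1) / I\<^sub>1(s)\<close> is a rational function of \<open>s\<close>, as a single
  integration by parts shows (\<open>wt_integral_1_recurrence\<close>). The integral \<open>I\<^sub>0\<close> is a beta
  integral and has such a recurrence anyway. The quotient therefore satisfies the same recurrence
  \<open>s \<mapsto> s + 1\<close> as the quotient of Gamma functions on the right-hand side
  (\<open>Gamma_quotient_recurrence\<close>), and the ratio of the two sides is a function of period 1.

  That this periodic function is constant follows as in the Bohr-Mollerup theorem: an integral of
  \<open>s\<close>-th powers of a nonnegative function is logarithmically convex in \<open>s\<close>, and together with
  the recurrence this fixes its growth (\<open>wt_integral_ratio_tendsto\<close>), which agrees with that of the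
  Gamma quotient (\<open>Gamma_quotient_ratio_tendsto\<close>). At \<open>s = 1\<close> the series is 1, which determines the
  constant (\<open>wt_integral_quotient\<close>).

  The theorem is now known for \<open>a\<close> in the real segment \<open>[-1, -1/2]\<close>. After division by
  \<open>Gamma (3/2 - 4 * a)\<close> both sides are entire functions of \<open>a\<close>
  (\<open>regularised_F_holomorphic\<close>, \<open>closed_form_holomorphic\<close>), so the identity theorem extends the
  equality to all complex \<open>a\<close>.
\<close>

section \<open>A weighted integral and its integration-by-parts relation\<close>

text \<open>
  For \<open>e = 0\<close> the powers of this weight give a beta integral, for \<open>e = 1\<close> the integral to which
  the hypergeometric series sums. The number 5 in the weight encodes the argument \<open>1/5\<close> of the
  series: the interval of integration ends at the zeros \<open>\<plusminus>sqrt (1/5)\<close> of the first factor.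
\<close>

definition wt :: "real \<Rightarrow> real \<Rightarrow> real" where
  "wt e y = (1 - 5 * y\<^sup>2)\<^sup>2 * (1 + e * y)"

abbreviation K :: "real set" where
  "K \<equiv> {- sqrt (1/5)..sqrt (1/5)}"

definition wt_integral :: "real \<Rightarrow> real \<Rightarrow> real" where
  "wt_integral e s = integral K (\<lambda>y. wt e y powr s)"

lemma K_iff: "y \<in> K \<longleftrightarrow> 5 * y\<^sup>2 \<le> 1"
proof -
  have "y \<in> K \<longleftrightarrow> \<bar>y\<bar> \<le> sqrt (1/5)" by auto
  also have "\<dots> \<longleftrightarrow> y\<^sup>2 \<le> 1/5" 
    using real_sqrt_le_iff[of "y\<^sup>2" "1/5"] by (simp only: real_sqrt_abs)
  finally show ?thesis by auto
qed

lemma K_interior_iff: "y \<in> {- sqrt (1/5)<..<sqrt (1/5)} \<longleftrightarrow> 5 * y\<^sup>2 < 1"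
proof -
  have "y \<in> {- sqrt (1/5)<..<sqrt (1/5)} \<longleftrightarrow> \<bar>y\<bar> < sqrt (1/5)" by auto
  also have "\<dots> \<longleftrightarrow> y\<^sup>2 < 1/5" 
    using real_sqrt_less_iff[of "y\<^sup>2" "1/5"] by (simp only: real_sqrt_abs)
  finally show ?thesis by auto
qed

lemma K_small: assumes "y \<in> K" shows "\<bar>y\<bar> < 1/2"
proof -
  have "y\<^sup>2 < (1/2)\<^sup>2" using assms unfolding K_iff by (simp add: power2_eq_square)
  then show ?thesis
    by (metis abs_of_nonneg half_gt_zero_iff less_eq_real_def power2_less_imp_less power2_abs zero_less_one abs_ge_zero)
qed

lemma lin_pos:
  fixes e y :: real
  assumes "e \<in> {0..1}" "y \<in> K" shows "0 < 1 + e * y"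
proof -
  have "\<bar>e * y\<bar> \<le> 1 * (1/2)"
    unfolding abs_mult using assms K_small[OF assms(2)] by (intro mult_mono) auto
  then show ?thesis by linarith
qed

lemma wt_nonneg: "e \<in> {0..1} \<Longrightarrow> y \<in> K \<Longrightarrow> 0 \<le> wt e y"
  using lin_pos[of e y] by (simp add: wt_def)

lemma wt_pos:
  assumes "e \<in> {0..1}" "y \<in> {- sqrt (1/5)<..<sqrt (1/5)}" shows "0 < wt e y"
  using lin_pos[of e y] assms K_interior_iff[of y] by (simp add: wt_def)

lemma continuous_wt_powr:
  assumes "e \<in> {0..1}" "s > 0"
  shows "continuous_on K (\<lambda>y. wt e y powr s)"
  using assms wt_nonneg[OF assms(1)]
  by (intro continuous_on_powr' continuous_intros) (auto simp: wt_def intro!: continuous_intros)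

lemma integrable_wt_powr:
  assumes "e \<in> {0..1}" "s > 0" "continuous_on K f"
  shows "(\<lambda>y. wt e y powr s * f y) integrable_on K"
  by (intro integrable_continuous_real continuous_on_mult continuous_wt_powr assms)

lemma wt_integral_pos:
  assumes e: "e \<in> {0..1}" and s: "s > 0"
  shows "wt_integral e s > 0"
proof -
  let ?f = "\<lambda>y. wt e y powr s"
  have c: "continuous_on K ?f" by (rule continuous_wt_powr[OF e s])
  have "wt_integral e s \<ge> 0" unfolding wt_integral_def
    by (intro integral_nonneg integrable_continuous_real c) auto
  moreover have "wt_integral e s \<noteq> 0"
  proof
    assume "wt_integral e s = 0"
    then have i0: "(?f has_integral 0) (cbox (- sqrt (1/5)) (sqrt (1/5)))"
      unfolding wt_integral_def using integrable_integral[OF integrable_continuous_real[OF c]] by simp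
    have "?f 0 = 0"
      by (intro has_integral_0_cbox_imp_0[OF _ _ i0]) (use c in auto)
    then show False by (simp add: wt_def)
  qed
  ultimately show ?thesis by linarith
qed

lemma wt_powr_add_one:
  assumes "e \<in> {0..1}" "y \<in> K"
  shows "wt e y powr (s + 1) = wt e y powr s * wt e y"
  using wt_nonneg[OF assms] by (simp add: powr_add)

text \<open>
  The integrand is the derivative of \<open>wt e y powr s * ((1 - 5 * y\<^sup>2) * (1 + e * y) * B y)\<close>, which
  vanishes at both ends of the interval. The factor \<open>(1 - 5 * y\<^sup>2) * (1 + e * y)\<close> clears the
  denominators of the logarithmic derivative of the weight, so that a polynomial \<open>B\<close> yields a
  polynomial multiple of \<open>wt e y powr s\<close>. Every linear relation between integrals below comes from
  a suitable \<open>B\<close>.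
\<close>

lemma integral_total_derivative:
  assumes e: "e \<in> {0..1}" and s: "s > 0"
    and B: "\<And>y. (B has_real_derivative B' y) (at y)"
  shows "((\<lambda>y. wt e y powr s *
           ((s * (e * (1 - 5 * y\<^sup>2) - 20 * y * (1 + e * y)) + e * (1 - 5 * y\<^sup>2) - 10 * y * (1 + e * y)) * B y
            + (1 - 5 * y\<^sup>2) * (1 + e * y) * B' y)) has_integral 0) K"
proof -
  define f where "f y = wt e y powr s * ((1 - 5 * y\<^sup>2) * (1 + e * y) * B y)" for y
  let ?f' = "\<lambda>y. wt e y powr s *
           ((s * (e * (1 - 5 * y\<^sup>2) - 20 * y * (1 + e * y)) + e * (1 - 5 * y\<^sup>2) - 10 * y * (1 + e * y)) * B y
            + (1 - 5 * y\<^sup>2) * (1 + e * y) * B' y)"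
  have contB: "continuous_on A B" for A
    by (rule continuous_at_imp_continuous_on) (use B DERIV_isCont in blast)
  have "(?f' has_integral (f (sqrt (1/5)) - f (- sqrt (1/5)))) K"
  proof (rule fundamental_theorem_of_calculus_interior)
    show "continuous_on K f" unfolding f_def
      by (intro continuous_on_mult continuous_wt_powr e s continuous_intros contB)
    fix y assume y: "y \<in> {- sqrt (1/5)<..<sqrt (1/5)}"
    have w: "0 < wt e y" by (rule wt_pos[OF e y])
    have l: "1 + e * y \<noteq> 0" "1 - 5 * y\<^sup>2 \<noteq> 0" using w by (auto simp: wt_def)
    define w' where "w' = 2 * (1 - 5 * y\<^sup>2) * (- 10 * y) * (1 + e * y) + (1 - 5 * y\<^sup>2)\<^sup>2 * e"
    have dw: "(wt e has_real_derivative w') (at y)"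
      unfolding wt_def[abs_def] w'_def
      by (auto intro!: derivative_eq_intros simp: power2_eq_square algebra_simps)
    have "((\<lambda>y. wt e y powr s) has_real_derivative (s * wt e y powr (s - 1) * w')) (at y)"
      using DERIV_chain2[OF has_real_derivative_powr[OF w] dw] .
    also have "s * wt e y powr (s - 1) * w' = wt e y powr s * (s * w' / wt e y)"
      using w by (simp add: powr_diff)
    finally have dp: "((\<lambda>y. wt e y powr s) has_real_derivative (wt e y powr s * (s * w' / wt e y))) (at y)" .
    have dq: "((\<lambda>y. (1 - 5 * y\<^sup>2) * (1 + e * y) * B y) has_real_derivative
        ((- 10 * y * (1 + e * y) + (1 - 5 * y\<^sup>2) * e) * B y + (1 - 5 * y\<^sup>2) * (1 + e * y) * B' y)) (at y)"
      by (auto intro!: derivative_eq_intros B simp: algebra_simps power2_eq_square)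
    have "(f has_real_derivative
       (wt e y powr s * (s * w' / wt e y) * ((1 - 5 * y\<^sup>2) * (1 + e * y) * B y)
        + wt e y powr s * ((- 10 * y * (1 + e * y) + (1 - 5 * y\<^sup>2) * e) * B y + (1 - 5 * y\<^sup>2) * (1 + e * y) * B' y))) (at y)"
      using DERIV_mult[OF dp dq] unfolding f_def by (simp add: mult_ac)
    also have "s * w' / wt e y = s * (2 * (- 10 * y) / (1 - 5 * y\<^sup>2) + e / (1 + e * y))"
      unfolding w'_def wt_def using l by (simp add: divide_simps power2_eq_square) (simp add: algebra_simps)
    also have "wt e y powr s * (s * (2 * (- 10 * y) / (1 - 5 * y\<^sup>2) + e / (1 + e * y))) * ((1 - 5 * y\<^sup>2) * (1 + e * y) * B y)
        = wt e y powr s * (s * (e * (1 - 5 * y\<^sup>2) - 20 * y * (1 + e * y)) * B y)"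
      using l by (simp add: divide_simps)
    also have "wt e y powr s * (s * (e * (1 - 5 * y\<^sup>2) - 20 * y * (1 + e * y)) * B y)
        + wt e y powr s * ((- 10 * y * (1 + e * y) + (1 - 5 * y\<^sup>2) * e) * B y + (1 - 5 * y\<^sup>2) * (1 + e * y) * B' y) = ?f' y"
      by (simp add: algebra_simps)
    finally show "(f has_vector_derivative ?f' y) (at y)"
      by (simp add: has_real_derivative_iff_has_vector_derivative)
  qed auto
  moreover have "f (sqrt (1/5)) = 0" "f (- sqrt (1/5)) = 0" by (simp_all add: f_def)
  ultimately show ?thesis by simp
qed

section \<open>Recurrences in the exponent\<close>

text \<open>
  This recurrence is where the argument \<open>1/5\<close> is special. The polynomial
  \<open>\<rho> - wt 1 y\<close> of degree 5 in \<open>y\<close> must be an integration-by-parts expression for a cubic \<open>B\<close>: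
  six equations for the four coefficients of \<open>B\<close> and the constant \<open>\<rho>\<close>. For this weight the
  overdetermined system is solvable, and the solution is the \<open>B\<close> of the proof.
\<close>

lemma wt_integral_1_recurrence:
  assumes s: "s > 0"
  shows "wt_integral 1 (s + 1) = 128/125 * ((s + 1/2) * (s + 1)) / ((s + 4/5) * (s + 6/5)) * wt_integral 1 s"
proof -
  define B where "B y = (3 * s + 4) / 5 - (13 * s + 12) * y + (5 * s + 4) * y\<^sup>2 + (25 * s + 20) * y ^ 3" for y
  define B' where "B' y = - (13 * s + 12) + 2 * (5 * s + 4) * y + 3 * (25 * s + 20) * y\<^sup>2" for y
  have dB: "(B has_real_derivative B' y) (at y)" for y
    unfolding B_def[abs_def] B'_def by (auto intro!: derivative_eq_intros simp: power2_eq_square algebra_simps)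
  let ?R = "128/5 * ((s + 1/2) * (s + 1))" and ?D = "(5 * s + 4) * (5 * s + 6)"
  have "(s * (1 * (1 - 5 * y\<^sup>2) - 20 * y * (1 + 1 * y)) + 1 * (1 - 5 * y\<^sup>2) - 10 * y * (1 + 1 * y)) * B y
            + (1 - 5 * y\<^sup>2) * (1 + 1 * y) * B' y = ?R - ?D * wt 1 y" for y
    unfolding B_def B'_def wt_def
    by (simp add: field_simps power2_eq_square power3_eq_cube)
  then have "((\<lambda>y. wt 1 y powr s * (?R - ?D * wt 1 y)) has_integral 0) K"
    using integral_total_derivative[of 1 s B B', OF _ s dB] by simp
  moreover have "((\<lambda>y. ?R * (wt 1 y powr s) - ?D * wt 1 y powr (s + 1)) has_integral (?R * wt_integral 1 s - ?D * wt_integral 1 (s + 1))) K"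
    unfolding wt_integral_def using s
    by (intro has_integral_diff has_integral_mult_right integrable_integral integrable_continuous_real continuous_wt_powr) auto
  then have "((\<lambda>y. wt 1 y powr s * (?R - ?D * wt 1 y)) has_integral (?R * wt_integral 1 s - ?D * wt_integral 1 (s + 1))) K"
    by (rule has_integral_eq[rotated]) (use wt_powr_add_one[of 1 _ s] in \<open>auto simp: algebra_simps\<close>)
  ultimately have "?R * wt_integral 1 s = ?D * wt_integral 1 (s + 1)"
    by (auto dest: has_integral_unique)
  moreover have "?D > 0" using s by simp
  moreover have "(s + 4/5) * (s + 6/5) = ?D / 25" by (simp add: field_simps)
  ultimately show ?thesis by (simp add: field_simps)
qed

lemma wt_integral_0_recurrence:
  assumes s: "s > 0"
  shows "wt_integral 0 (s + 1) = (s + 1/2) * (s + 1) / ((s + 3/4) * (s + 5/4)) * wt_integral 0 s"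
proof -
  define B where "B y = (4 * s + 3) * (1 - 5 * y\<^sup>2) * y + (4 * s + 4) * y" for y
  define B' where "B' y = (4 * s + 3) * (1 - 15 * y\<^sup>2) + (4 * s + 4)" for y
  have dB: "(B has_real_derivative B' y) (at y)" for y
    unfolding B_def[abs_def] B'_def by (auto intro!: derivative_eq_intros simp: power2_eq_square algebra_simps)
  let ?R = "(4 * s + 4) * (4 * s + 2)" and ?D = "(4 * s + 3) * (4 * s + 5)"
  have "(s * (0 * (1 - 5 * y\<^sup>2) - 20 * y * (1 + 0 * y)) + 0 * (1 - 5 * y\<^sup>2) - 10 * y * (1 + 0 * y)) * B y
            + (1 - 5 * y\<^sup>2) * (1 + 0 * y) * B' y = ?D * wt 0 y - ?R" for y
    unfolding B_def B'_def wt_def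
    by (simp add: algebra_simps power2_eq_square)
  then have "((\<lambda>y. wt 0 y powr s * (?D * wt 0 y - ?R)) has_integral 0) K"
    using integral_total_derivative[of 0 s B B', OF _ s dB] by simp
  moreover have "((\<lambda>y. ?D * wt 0 y powr (s + 1) - ?R * (wt 0 y powr s)) has_integral (?D * wt_integral 0 (s + 1) - ?R * wt_integral 0 s)) K"
    unfolding wt_integral_def using s
    by (intro has_integral_diff has_integral_mult_right integrable_integral integrable_continuous_real continuous_wt_powr) auto
  then have "((\<lambda>y. wt 0 y powr s * (?D * wt 0 y - ?R)) has_integral (?D * wt_integral 0 (s + 1) - ?R * wt_integral 0 s)) K"
    by (rule has_integral_eq[rotated]) (use wt_powr_add_one[of 0 _ s] in \<open>auto simp: algebra_simps\<close>)
  ultimately have "?R * wt_integral 0 s = ?D * wt_integral 0 (s + 1)"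
    by (auto dest: has_integral_unique)
  moreover have "?D > 0" using s by simp
  moreover have "(s + 3/4) * (s + 5/4) = ?D / 16" "(s + 1/2) * (s + 1) = ?R / 16" by (simp_all add: field_simps)
  ultimately show ?thesis by (simp add: field_simps)
qed

section \<open>The hypergeometric series as a quotient of two integrals\<close>

definition moment :: "real \<Rightarrow> nat \<Rightarrow> real" where
  "moment s k = integral K (\<lambda>y. wt 0 y powr s * y ^ k)"

lemma moment_odd: assumes "odd k" shows "moment s k = 0"
proof -
  have "moment s k = integral K (\<lambda>y. wt 0 (- y) powr s * (- y) ^ k)"
    unfolding moment_def using Henstock_Kurzweil_Integration.integral_reflect_real[of "sqrt (1/5)" "- sqrt (1/5)" "\<lambda>y. wt 0 y powr s * y ^ k"]
    by simp
  also have "\<dots> = - moment s k"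
    using assms unfolding moment_def by (simp add: wt_def)
  finally show ?thesis by simp
qed

text \<open>
  The case \<open>e = 0\<close>, \<open>B y = y ^ (m + 1)\<close> of the integration-by-parts relation. It takes the place
  of an evaluation of the moments by beta functions.
\<close>

lemma moment_step:
  assumes s: "s > 0"
  shows "5 * (real m + 4 * s + 3) * moment s (m + 2) = (real m + 1) * moment s m"
proof -
  have dB: "((\<lambda>y. y ^ (m + 1)) has_real_derivative (real m + 1) * y ^ m) (at y)" for y
    using DERIV_pow[of "m + 1" y] by (simp add: add_ac)
  have "((\<lambda>y. wt 0 y powr s * ((real m + 1) * y ^ m - 5 * (real m + 4 * s + 3) * y ^ (m + 2))) has_integral 0) K"
    using integral_total_derivative[of 0 s "\<lambda>y. y ^ (m + 1)" "\<lambda>y. (real m + 1) * y ^ m", OF _ s dB]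
    by (simp add: algebra_simps power2_eq_square)
  moreover have "((\<lambda>y. (real m + 1) * (wt 0 y powr s * y ^ m) - 5 * (real m + 4 * s + 3) * (wt 0 y powr s * y ^ (m + 2)))
       has_integral ((real m + 1) * moment s m - 5 * (real m + 4 * s + 3) * moment s (m + 2))) K"
    unfolding moment_def using s
    by (intro has_integral_diff has_integral_mult_right integrable_integral integrable_wt_powr continuous_intros) auto
  then have "((\<lambda>y. wt 0 y powr s * ((real m + 1) * y ^ m - 5 * (real m + 4 * s + 3) * y ^ (m + 2)))
       has_integral ((real m + 1) * moment s m - 5 * (real m + 4 * s + 3) * moment s (m + 2))) K"
    by (rule has_integral_eq[rotated]) (auto simp: algebra_simps)
  ultimately show ?thesis by (auto dest: has_integral_unique)
qed

lemma moment_0: "moment s 0 = wt_integral 0 s"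
  by (simp add: moment_def wt_integral_def)

lemma moment_even:
  assumes s: "s > 0"
  shows "moment s (2 * k) = pochhammer (1/2) k / (pochhammer (3/2 + 2 * s) k * 5 ^ k) * wt_integral 0 s"
proof (induction k)
  case 0
  show ?case by (simp add: moment_0)
next
  case (Suc k)
  have p: "3/2 + 2 * s + real k > 0" using s by simp
  have pp: "pochhammer (3/2 + 2 * s) k > 0" using s by (intro pochhammer_pos) auto
  have "10 * (3/2 + 2 * s + real k) * moment s (2 * Suc k) = 2 * (1/2 + real k) * moment s (2 * k)"
    using moment_step[OF s, of "2 * k"] by (simp add: algebra_simps)
  then have "moment s (2 * Suc k) = (1/2 + real k) / (5 * (3/2 + 2 * s + real k)) * moment s (2 * k)"
    using p by (simp add: field_simps)
  then show ?case unfolding Suc using p pp by (simp add: pochhammer_Suc field_simps)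
qed

text \<open>
  The factor \<open>(1 + y) powr s\<close> of \<open>wt 1 y powr s\<close> is expanded by the binomial series. This may be
  integrated term by term because \<open>\<bar>y\<bar> \<le> sqrt (1/5) < 1\<close> makes the convergence uniform.
\<close>

lemma binomial_moment_sums:
  assumes s: "s > 0"
  shows "(\<lambda>k. (s gchoose k) * moment s k) sums wt_integral 1 s"
proof -
  let ?f = "\<lambda>k y. (s gchoose k) * (wt 0 y powr s * y ^ k)"
  have sum: "summable (\<lambda>k. norm ((s gchoose k) * (sqrt (1/5)) ^ k))"
  proof (rule powser_insidea)
    show "summable (\<lambda>k. (s gchoose k) * (1/2) ^ k)"
      using gen_binomial_real[of "1/2" s] by (auto dest: sums_summable)
    show "norm (sqrt (1/5)) < norm (1/2::real)"
      using K_small[of "sqrt (1/5)"] by simp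
  qed
  have "uniform_limit K (\<lambda>n y. \<Sum>k<n. ?f k y) (\<lambda>y. \<Sum>k. ?f k y) sequentially"
  proof (rule Weierstrass_m_test[OF _ sum])
    fix k y assume y: "y \<in> K"
    have "0 \<le> 1 - 5 * y\<^sup>2" "1 - 5 * y\<^sup>2 \<le> 1" using y unfolding K_iff by auto
    then have "wt 0 y \<le> 1" by (simp add: wt_def power_le_one)
    then have "wt 0 y powr s \<le> 1 powr s"
      using s wt_nonneg[OF _ y, of 0] by (intro powr_mono2) auto
    moreover have "\<bar>y\<bar> ^ k \<le> sqrt (1/5) ^ k" using y by (intro power_mono) auto
    ultimately have "wt 0 y powr s * \<bar>y\<bar> ^ k \<le> 1 * sqrt (1/5) ^ k" 
      by (intro mult_mono) auto
    then show "norm (?f k y) \<le> norm ((s gchoose k) * (sqrt (1/5)) ^ k)"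
      by (simp add: abs_mult power_abs mult_left_mono)
  qed
  moreover have "(\<Sum>k. ?f k y) = wt 1 y powr s" if y: "y \<in> K" for y
  proof -
    have "(\<lambda>k. wt 0 y powr s * ((s gchoose k) * y ^ k)) sums (wt 0 y powr s * (1 + y) powr s)"
      using K_small[OF y] by (intro sums_mult gen_binomial_real) auto
    also have "wt 0 y powr s * (1 + y) powr s = (wt 0 y * (1 + y)) powr s"
      by (rule powr_mult [symmetric])
    also have "wt 0 y * (1 + y) = wt 1 y" by (simp add: wt_def)
    finally show ?thesis by (simp add: sums_iff mult_ac)
  qed
  ultimately have ul: "uniform_limit K (\<lambda>n y. \<Sum>k<n. ?f k y) (\<lambda>y. wt 1 y powr s) sequentially"
    by (subst uniform_limit_cong') auto
  have cont: "continuous_on K (\<lambda>y. \<Sum>k<n. ?f k y)" for n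
    using s by (intro continuous_intros continuous_wt_powr) auto
  obtain I J where I: "\<And>n. ((\<lambda>y. \<Sum>k<n. ?f k y) has_integral I n) K"
    and J: "((\<lambda>y. wt 1 y powr s) has_integral J) K" and lim: "I \<longlonglongrightarrow> J"
    by (rule uniform_limit_integral[OF ul cont]) auto
  have "I = (\<lambda>n. \<Sum>k<n. (s gchoose k) * moment s k)"
  proof
    fix n
    have "((\<lambda>y. \<Sum>k<n. ?f k y) has_integral (\<Sum>k<n. (s gchoose k) * moment s k)) K"
      unfolding moment_def using s
      by (intro has_integral_sum has_integral_mult_right integrable_integral integrable_wt_powr continuous_intros) auto
    then show "I n = (\<Sum>k<n. (s gchoose k) * moment s k)" by (rule has_integral_unique[OF I])
  qed
  moreover have "J = wt_integral 1 s" unfolding wt_integral_def using J by (simp add: integral_unique)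
  ultimately show ?thesis using lim by (simp add: sums_def)
qed

text \<open>
  Odd moments vanish, and the even ones divided by the zeroth one are
  \<open>pochhammer (1/2) k / pochhammer (3/2 + 2 * s) k\<close> up to powers of 5. The duplication formulas for \<open>pochhammer (- s) (2 * k)\<close> and for \<open>fact (2 * k)\<close> turn
  \<open>s gchoose (2 * k)\<close> into the remaining factors of the hypergeometric term; in particular the
  shift by \<open>1/2\<close> between the two upper parameters comes from there.
\<close>

lemma hypergeometric_sums:
  assumes s: "s > 0"
  shows "(\<lambda>k. pochhammer (- s / 2) k * pochhammer ((1 - s) / 2) k / (pochhammer (3/2 + 2 * s) k * pochhammer 1 k) * (1/5) ^ k)
           sums (wt_integral 1 s / wt_integral 0 s)"
proof -
  have I0: "wt_integral 0 s > 0" using s by (intro wt_integral_pos) auto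
  have "odd n" if "n \<notin> range ((*) 2)" for n :: nat using that by blast
  then have "(\<lambda>k. (s gchoose (2 * k)) * moment s (2 * k)) sums wt_integral 1 s"
    using binomial_moment_sums[OF s]
    by (subst sums_mono_reindex[where g = "(*) 2"]) (auto simp: strict_mono_def moment_odd)
  then have "(\<lambda>k. (s gchoose (2 * k)) * moment s (2 * k) / wt_integral 0 s) sums (wt_integral 1 s / wt_integral 0 s)"
    by (rule sums_divide)
  moreover have "(s gchoose (2 * k)) * moment s (2 * k) / wt_integral 0 s =
      pochhammer (- s / 2) k * pochhammer ((1 - s) / 2) k / (pochhammer (3/2 + 2 * s) k * pochhammer 1 k) * (1/5) ^ k" for k
  proof -
    have p: "pochhammer (1/2 :: real) k > 0" "pochhammer (3/2 + 2 * s) k > 0"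
      using s by (auto intro!: pochhammer_pos)
    have half: "- s / 2 + 1/2 = (1 - s) / 2" by (simp add: field_simps)
    have 1: "pochhammer (- s) (2 * k) = 2 ^ (2 * k) * pochhammer (- s / 2) k * pochhammer ((1 - s) / 2) k"
      using pochhammer_double[of "- s / 2" k] unfolding half by simp
    have 2: "pochhammer (1::real) k = fact k" by (simp add: pochhammer_fact)
    have "(s gchoose (2 * k)) = pochhammer (- s / 2) k * pochhammer ((1 - s) / 2) k / (pochhammer (1/2) k * fact k)"
      unfolding gbinomial_pochhammer 1 fact_double by simp
    then show ?thesis unfolding moment_even[OF s] 2 using I0 p by (simp add: field_simps power_divide)
  qed
  ultimately show ?thesis by simp
qed

lemma hypergeo_F_eq_quotient:
  assumes s: "s > 0"
  shows "hypergeo_F (of_real (- s / 2)) (of_real (- s / 2) + 1/2) (3/2 - 4 * of_real (- s / 2)) (1/5)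
     = of_real (wt_integral 1 s / wt_integral 0 s)"
proof -
  have "of_real (- s / 2) + 1/2 = (of_real ((1 - s) / 2) :: complex)"
       "3/2 - 4 * of_real (- s / 2) = (of_real (3/2 + 2 * s) :: complex)"
    by (simp_all add: field_simps)
  moreover have "(\<lambda>k. of_real (pochhammer (- s / 2) k * pochhammer ((1 - s) / 2) k / (pochhammer (3/2 + 2 * s) k * pochhammer 1 k) * (1/5) ^ k))
     sums (of_real (wt_integral 1 s / wt_integral 0 s) :: complex)"
    using hypergeometric_sums[OF s] by (rule sums_of_real)
  moreover have "of_real (pochhammer A k * pochhammer B k / (pochhammer C k * pochhammer 1 k) * (1/5) ^ k) =
      (pochhammer (of_real A) k * pochhammer (of_real B) k / (pochhammer (of_real C) k * pochhammer 1 k) * (1/5) ^ k :: complex)"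
      for A B C k
    by (simp add: pochhammer_of_real flip: pochhammer_fact)
  ultimately show ?thesis
    unfolding hypergeo_F_def by (simp only: sums_iff)
qed

section \<open>Growth of the integrals in the exponent\<close>

text \<open>
  Hoelder's inequality, that is, logarithmic convexity of the integral as a function of the
  exponent. It is obtained by integrating Young's inequality \<open>x powr t \<le> (1 - t) + t * x\<close> at
  \<open>x = wt e y / r\<close>; with \<open>r\<close> the quotient of the integrals at \<open>s + 1\<close> and \<open>s\<close>, the integral of
  \<open>(1 - t) + t * x\<close> against \<open>wt e y powr s\<close> is again the integral at \<open>s\<close>.
\<close>

lemma wt_integral_interpolate:
  assumes e: "e \<in> {0..1}" and s: "s > 0" and t: "t \<in> {0..1}"
  shows "wt_integral e (s + t) \<le> (wt_integral e (s + 1) / wt_integral e s) powr t * wt_integral e s"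
proof -
  define r where "r = wt_integral e (s + 1) / wt_integral e s"
  have I: "wt_integral e s > 0" "wt_integral e (s + 1) > 0" using e s by (auto intro: wt_integral_pos)
  then have r: "r > 0" by (simp add: r_def)
  have "wt_integral e (s + t) \<le> integral K (\<lambda>y. r powr t * ((1 - t) * wt e y powr s + t / r * wt e y powr (s + 1)))"
    unfolding wt_integral_def
  proof (rule integral_le)
    show "(\<lambda>y. wt e y powr (s + t)) integrable_on K"
      using e s t by (intro integrable_continuous_real continuous_wt_powr) auto
    show "(\<lambda>y. r powr t * ((1 - t) * wt e y powr s + t / r * wt e y powr (s + 1))) integrable_on K"
      using e s t by (intro integrable_continuous_real continuous_intros continuous_wt_powr) auto
    fix y assume y: "y \<in> K"
    show "wt e y powr (s + t) \<le> r powr t * ((1 - t) * wt e y powr s + t / r * wt e y powr (s + 1))"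
    proof (cases "wt e y = 0")
      case True
      then show ?thesis by simp
    next
      case False
      then have w: "wt e y > 0" using wt_nonneg[OF e y] by simp
      have "1 powr (1 - t) * (wt e y / r) powr t \<le> (1 - t) * 1 + t * (wt e y / r)"
        using t w r by (intro Youngs_inequality_0) auto
      then have "r powr t * wt e y powr s * (wt e y / r) powr t
           \<le> r powr t * wt e y powr s * ((1 - t) + t * (wt e y / r))"
        by (intro mult_left_mono) auto
      also have "r powr t * wt e y powr s * (wt e y / r) powr t = wt e y powr (s + t)"
        using r w by (simp add: powr_divide powr_add)
      finally show ?thesis
        using w by (simp add: powr_add algebra_simps)
    qed
  qed
  also have "\<dots> = r powr t * ((1 - t) * wt_integral e s + t / r * wt_integral e (s + 1))"
    unfolding wt_integral_def using e s
    by (intro integral_unique has_integral_mult_right has_integral_add integrable_integral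
          integrable_continuous_real continuous_wt_powr) auto
  also have "\<dots> = r powr t * wt_integral e s"
    using I by (simp add: r_def field_simps)
  finally show ?thesis by (simp add: r_def)
qed

text \<open>
  The squeeze of the Bohr-Mollerup theorem. Interpolating \<open>s + t\<close> between \<open>s\<close> and \<open>s + 1\<close> bounds
  the quotient from above by \<open>\<rho> s powr t\<close>; interpolating \<open>s + 1\<close> between \<open>s + t\<close> and \<open>s + t + 1\<close>
  bounds it from below by \<open>\<rho> s * \<rho> (s + t) powr (t - 1)\<close>. Both bounds tend to \<open>L powr t\<close>.
\<close>

lemma wt_integral_ratio_tendsto:
  assumes e: "e \<in> {0..1}" and t: "t \<in> {0..1}"
    and rec: "\<And>s. s > 0 \<Longrightarrow> wt_integral e (s + 1) = \<rho> s * wt_integral e s"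
    and lim: "(\<rho> \<longlongrightarrow> L) at_top" and L: "L > 0"
  shows "((\<lambda>s. wt_integral e (s + t) / wt_integral e s) \<longlongrightarrow> L powr t) at_top"
proof (rule tendsto_sandwich)
  have pos: "wt_integral e s > 0" if "s > 0" for s by (rule wt_integral_pos[OF e that])
  have r: "wt_integral e (s + 1) / wt_integral e s = \<rho> s" "\<rho> s > 0" if "s > 0" for s
  proof -
    show "wt_integral e (s + 1) / wt_integral e s = \<rho> s" using rec[OF that] pos[OF that] by simp
    then show "\<rho> s > 0" using pos[OF that] pos[of "s + 1"] that
      by (metis add_pos_pos divide_pos_pos zero_less_one)
  qed
  show "eventually (\<lambda>s. wt_integral e (s + t) / wt_integral e s \<le> \<rho> s powr t) at_top"
    using eventually_gt_at_top[of 0]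
  proof eventually_elim
    case (elim s)
    then show ?case using wt_integral_interpolate[OF e elim t] pos[OF elim] unfolding r(1)[OF elim] by (simp add: field_simps)
  qed
  show "eventually (\<lambda>s. \<rho> s * \<rho> (s + t) powr (t - 1) \<le> wt_integral e (s + t) / wt_integral e s) at_top"
    using eventually_gt_at_top[of 0]
  proof eventually_elim
    case (elim s)
    have st: "s + t > 0" using elim t by simp
    have "wt_integral e (s + t + (1 - t)) \<le> \<rho> (s + t) powr (1 - t) * wt_integral e (s + t)"
      using wt_integral_interpolate[OF e st, of "1 - t"] t by (simp only: r[OF st]) simp
    then have "\<rho> s * wt_integral e s \<le> \<rho> (s + t) powr (1 - t) * wt_integral e (s + t)"
      using rec[OF elim] by simp
    then have "\<rho> (s + t) powr (t - 1) * (\<rho> s * wt_integral e s)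
        \<le> \<rho> (s + t) powr (t - 1) * (\<rho> (s + t) powr (1 - t) * wt_integral e (s + t))"
      by (rule mult_left_mono) auto
    also have "\<dots> = (\<rho> (s + t) powr (t - 1) * \<rho> (s + t) powr (1 - t)) * wt_integral e (s + t)"
      by simp
    also have "\<rho> (s + t) powr (t - 1) * \<rho> (s + t) powr (1 - t) = 1"
      using r(2)[OF st] by (simp flip: powr_add)
    finally show ?case using pos[OF elim] by (simp add: field_simps)
  qed
  show "((\<lambda>s. \<rho> s powr t) \<longlongrightarrow> L powr t) at_top"
    using L by (intro tendsto_intros lim) auto
  have "((\<lambda>s. \<rho> (s + t)) \<longlongrightarrow> L) at_top"
    by (rule filterlim_compose[OF lim]) real_asymp
  then have "((\<lambda>s. \<rho> s * \<rho> (s + t) powr (t - 1)) \<longlongrightarrow> L * L powr (t - 1)) at_top"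
    using L by (intro tendsto_intros lim) auto
  also have "L * L powr (t - 1) = L powr t" using L by (simp add: powr_diff)
  finally show "((\<lambda>s. \<rho> s * \<rho> (s + t) powr (t - 1)) \<longlongrightarrow> L powr t) at_top" .
qed

section \<open>The Gamma quotient\<close>

text \<open>
  The quotient is \<open>Gamma z / Gamma_series z n\<close>, so this is Euler's product for \<open>\<Gamma>\<close>.
\<close>

lemma Gamma_fact_asymp:
  fixes z :: real
  assumes z: "z > 0"
  shows "(\<lambda>n. Gamma (z + real n + 1) / (fact n * real n powr z)) \<longlonglongrightarrow> 1"
proof -
  have z': "z \<notin> \<int>\<^sub>\<le>\<^sub>0" using z by (auto elim!: nonpos_Ints_cases)
  have G: "Gamma z > 0" using z by (rule Gamma_real_pos)
  have "(\<lambda>n. Gamma z / Gamma_series z n) \<longlonglongrightarrow> Gamma z / Gamma z"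
    using G by (intro tendsto_intros) auto
  moreover have "eventually (\<lambda>n. Gamma z / Gamma_series z n = Gamma (z + real n + 1) / (fact n * real n powr z)) sequentially"
    using eventually_gt_at_top[of 0]
  proof eventually_elim
    case (elim n)
    have "Gamma (z + real n + 1) = pochhammer z (n + 1) * Gamma z"
      using pochhammer_Gamma[OF z', of "n + 1"] G by (simp add: add_ac)
    then show ?case
      using elim by (simp add: Gamma_series_def powr_def)
  qed
  ultimately show ?thesis
    using G by (simp add: tendsto_cong)
qed

lemma Gamma_ratio_asymp:
  fixes z t :: real
  assumes "z > 0" "z + t > 0"
  shows "(\<lambda>n. Gamma (z + t + real n + 1) / (Gamma (z + real n + 1) * real n powr t)) \<longlonglongrightarrow> 1"
proof -
  have "(\<lambda>n. (Gamma (z + t + real n + 1) / (fact n * real n powr (z + t))) /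
             (Gamma (z + real n + 1) / (fact n * real n powr z))) \<longlonglongrightarrow> 1 / 1"
    using assms by (intro tendsto_divide Gamma_fact_asymp) auto
  moreover have "eventually (\<lambda>n. (Gamma (z + t + real n + 1) / (fact n * real n powr (z + t))) /
             (Gamma (z + real n + 1) / (fact n * real n powr z))
       = Gamma (z + t + real n + 1) / (Gamma (z + real n + 1) * real n powr t)) sequentially"
    using eventually_gt_at_top[of 0] by eventually_elim (simp add: powr_add field_simps)
  ultimately show ?thesis by (simp add: tendsto_cong)
qed

text \<open>
  Up to a constant factor, this is the value that the theorem predicts for \<open>s = - 2 * a\<close>: there
  \<open>5 powr (6 * a) / 2 powr (10 * a)\<close> becomes \<open>(32/125) powr s\<close>.
\<close>

definition Gamma_quotient :: "real \<Rightarrow> real" where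
  "Gamma_quotient s = (32/125) powr s * Gamma (3/2 + 2 * s) / (Gamma (4/5 + s) * Gamma (6/5 + s))"

lemma Gamma_quotient_pos: "s > 0 \<Longrightarrow> Gamma_quotient s > 0"
  unfolding Gamma_quotient_def by (intro mult_pos_pos divide_pos_pos Gamma_real_pos) auto

lemma Gamma_quotient_recurrence:
  assumes s: "s > 0"
  shows "Gamma_quotient (s + 1) = 128/125 * ((s + 3/4) * (s + 5/4)) / ((s + 4/5) * (s + 6/5)) * Gamma_quotient s"
proof -
  have G: "Gamma (x + 1) = x * Gamma x" if "x > 0" for x :: real
    using that by (intro Gamma_plus1) (auto elim!: nonpos_Ints_cases)
  have "Gamma (3/2 + 2 * (s + 1)) = Gamma ((3/2 + 2 * s) + 1 + 1)" by (simp add: algebra_simps)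
  also have "\<dots> = (3/2 + 2 * s + 1) * ((3/2 + 2 * s) * Gamma (3/2 + 2 * s))"
    using s by (simp only: G)
  finally have 1: "Gamma (3/2 + 2 * (s + 1)) = (3/2 + 2 * s + 1) * ((3/2 + 2 * s) * Gamma (3/2 + 2 * s))" .
  have 2: "Gamma (4/5 + (s + 1)) = (4/5 + s) * Gamma (4/5 + s)" "Gamma (6/5 + (s + 1)) = (6/5 + s) * Gamma (6/5 + s)"
    using s G[of "4/5 + s"] G[of "6/5 + s"] by (simp_all add: add_ac)
  have "Gamma_quotient (s + 1) = (32/125) powr s * (32/125) * ((3/2 + 2 * s + 1) * (3/2 + 2 * s)) * Gamma (3/2 + 2 * s) /
     (((s + 4/5) * (s + 6/5)) * (Gamma (4/5 + s) * Gamma (6/5 + s)))"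
    unfolding Gamma_quotient_def 1 2 by (simp add: powr_add add_ac mult_ac)
  also have "(32/125) powr s * (32/125) * ((3/2 + 2 * s + 1) * (3/2 + 2 * s)) = (32/125) powr s * (128/125 * ((s + 3/4) * (s + 5/4)))"
    by (simp add: algebra_simps)
  finally show ?thesis unfolding Gamma_quotient_def by (simp add: mult_ac)
qed

text \<open>
  The argument \<open>2 * s\<close> of the Gamma function in the numerator contributes \<open>(2 * n) powr (2 * t)\<close>,
  the two factors in the denominator contribute \<open>n powr t\<close> each. The powers of \<open>n\<close> cancel and
  \<open>4 powr t\<close> remains, whence \<open>128/125 = 4 * (32/125)\<close>.
\<close>

lemma Gamma_quotient_ratio_tendsto:
  assumes t: "t \<ge> 0"
  shows "(\<lambda>n. Gamma_quotient (1 + real n + t) / Gamma_quotient (1 + real n)) \<longlonglongrightarrow> (128/125) powr t"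
proof -
  define A where "A n = Gamma (5/2 + 2 * t + real n + 1) / (Gamma (5/2 + real n + 1) * real n powr (2 * t))" for n
  define B where "B z n = Gamma (z + t + real n + 1) / (Gamma (z + real n + 1) * real n powr t)" for z n
  have A: "(\<lambda>n. A (2 * n)) \<longlonglongrightarrow> 1"
    using LIMSEQ_subseq_LIMSEQ[OF Gamma_ratio_asymp[of "5/2" "2 * t"], of "\<lambda>n. 2 * n"] t
    unfolding A_def[abs_def] by (simp add: strict_mono_def o_def)
  have B: "B z \<longlonglongrightarrow> 1" if "z > 0" for z
    using Gamma_ratio_asymp[of z t] that t unfolding B_def[abs_def] by simp
  have "(\<lambda>n. (128/125) powr t * A (2 * n) / (B (4/5) n * B (6/5) n)) \<longlonglongrightarrow> (128/125) powr t * 1 / (1 * 1)"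
    by (intro tendsto_intros A B) auto
  moreover have "eventually (\<lambda>n. (128/125) powr t * A (2 * n) / (B (4/5) n * B (6/5) n) 
      = Gamma_quotient (1 + real n + t) / Gamma_quotient (1 + real n)) sequentially"
    using eventually_gt_at_top[of 0]
  proof eventually_elim
    case (elim n)
    define g where "g = real n powr t"
    have g: "g > 0" using elim by (simp add: g_def)
    have p: "Gamma x > 0" if "x > 0" for x :: real using that by (rule Gamma_real_pos)
    have "(2 * real n) powr (2 * t) = (2 powr 2) powr t * (real n powr t * real n powr t)"
      unfolding powr_mult powr_powr by (simp flip: powr_add)
    then have two: "real (2 * n) powr (2 * t) = 4 powr t * (g * g)" by (simp add: g_def)
    have four: "(128/125) powr t = 4 powr t * (32/125) powr t"
      by (simp flip: powr_mult)
    define a1 where "a1 = Gamma (3/2 + 2 * (1 + real n + t))"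
    define a2 where "a2 = Gamma (3/2 + 2 * (1 + real n))"
    define b1 where "b1 = Gamma (4/5 + (1 + real n + t))"
    define b2 where "b2 = Gamma (4/5 + (1 + real n))"
    define c1 where "c1 = Gamma (6/5 + (1 + real n + t))"
    define c2 where "c2 = Gamma (6/5 + (1 + real n))"
    have pos: "a2 > 0" "b1 > 0" "b2 > 0" "c1 > 0" "c2 > 0"
      unfolding a2_def b1_def b2_def c1_def c2_def using t by (auto intro!: p)
    have eA: "A (2 * n) = a1 / (a2 * (4 powr t * (g * g)))"
      unfolding A_def two a1_def a2_def by (simp add: algebra_simps)
    have eB: "B (4/5) n = b1 / (b2 * g)" "B (6/5) n = c1 / (c2 * g)"
      unfolding B_def b1_def b2_def c1_def c2_def g_def by (simp_all add: algebra_simps)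
    have eG: "Gamma_quotient (1 + real n + t) = (32/125) powr (1 + real n) * (32/125) powr t * a1 / (b1 * c1)"
      unfolding Gamma_quotient_def a1_def b1_def c1_def powr_add by simp
    have eG': "Gamma_quotient (1 + real n) = (32/125) powr (1 + real n) * a2 / (b2 * c2)"
      unfolding Gamma_quotient_def a2_def b2_def c2_def by simp
    have cancel: "X * Y * (a1 / (a2 * (X * (g * g)))) / (b1 / (b2 * g) * (c1 / (c2 * g)))
        = (P * Y * a1 / (b1 * c1)) / (P * a2 / (b2 * c2))" if "X > 0" "Y > 0" "P > 0" for X Y P :: real
      using that pos g by (simp add: field_simps)
    show ?case unfolding four eA eB eG eG' by (rule cancel) auto
  qed
  ultimately show ?thesis by (simp add: tendsto_cong)
qed

section \<open>Evaluation for real parameters\<close>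

text \<open>
  The two weights differ by an odd function.
\<close>

lemma wt_integrals_agree_at_1: "wt_integral 1 1 = wt_integral 0 1"
proof -
  have "wt_integral 1 1 = integral K (\<lambda>y. wt 0 y powr 1 * y ^ 0 + wt 0 y powr 1 * y ^ 1)"
    unfolding wt_integral_def
    by (intro integral_cong) (use wt_nonneg[of 0] wt_nonneg[of 1] in \<open>auto simp: wt_def algebra_simps\<close>)
  also have "\<dots> = moment 1 0 + moment 1 1"
    unfolding moment_def by (intro integral_add integrable_wt_powr continuous_intros) auto
  finally show ?thesis by (simp add: moment_odd moment_0)
qed

lemma Gamma_quotient_1: "Gamma_quotient 1 * (Gamma (4/5) * Gamma (6/5)) = Gamma (3/2)"
proof -
  have G: "Gamma (x + 1) = x * Gamma x" if "x > 0" for x :: real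
    using that by (intro Gamma_plus1) (auto elim!: nonpos_Ints_cases)
  have p: "Gamma (4/5) \<noteq> (0::real)" "Gamma (6/5) \<noteq> (0::real)"
    using Gamma_real_pos[of "4/5"] Gamma_real_pos[of "6/5"] by linarith+
  have "Gamma (7/2) = 15/4 * Gamma (3/2 :: real)"
    using G[of "3/2"] G[of "5/2"] by simp
  moreover have "Gamma (9/5) = 4/5 * Gamma (4/5 :: real)" "Gamma (11/5) = 6/5 * Gamma (6/5 :: real)"
    using G[of "4/5"] G[of "6/5"] by simp_all
  moreover have "Gamma_quotient 1 = 32/125 * Gamma (7/2) / (Gamma (9/5) * Gamma (11/5))"
    by (simp add: Gamma_quotient_def)
  ultimately have "Gamma_quotient 1 = 32/125 * (15/4 * Gamma (3/2)) / (4/5 * Gamma (4/5) * (6/5 * Gamma (6/5)))"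
    by (simp only:)
  then show ?thesis using p by simp
qed

text \<open>
  Both sides satisfy the same first-order recurrence, so their quotient has period 1. Both grow in
  the same way under a shift of the exponent by \<open>t\<close>, so the quotient at \<open>1 + n + t\<close> and the quotient
  at \<open>1 + n\<close> are asymptotically equal; by periodicity they are equal. At \<open>s = 1\<close> both sides are known.
\<close>

lemma wt_integral_quotient:
  assumes t: "t \<in> {0..1}"
  shows "wt_integral 1 (1 + t) / wt_integral 0 (1 + t) = Gamma (4/5) * Gamma (6/5) / Gamma (3/2) * Gamma_quotient (1 + t)"
proof -
  define h where "h s = wt_integral 1 s / wt_integral 0 s / Gamma_quotient s" for s
  have pos: "wt_integral 1 s > 0" "wt_integral 0 s > 0" "Gamma_quotient s > 0" if "s > 0" for s
    using that by (auto intro: wt_integral_pos Gamma_quotient_pos)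
  have per: "h (s + 1) = h s" if s: "s > 0" for s
  proof -
    have "h (s + 1) = (128/125 * ((s + 1/2) * (s + 1)) / ((s + 4/5) * (s + 6/5)) * wt_integral 1 s) /
      ((s + 1/2) * (s + 1) / ((s + 3/4) * (s + 5/4)) * wt_integral 0 s) /
      (128/125 * ((s + 3/4) * (s + 5/4)) / ((s + 4/5) * (s + 6/5)) * Gamma_quotient s)"
      unfolding h_def by (simp only: s wt_integral_1_recurrence wt_integral_0_recurrence Gamma_quotient_recurrence)
    also have "\<dots> = h s"
    proof -
      have cancel: "(128/125 * u / w * a) / (u / v * b) / (128/125 * v / w * c) = a / b / c"
        if "u \<noteq> 0" "v \<noteq> 0" "w \<noteq> 0" for u v w a b c :: real
        using that by simp
      show ?thesis unfolding h_def using s by (intro cancel) auto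
    qed
    finally show ?thesis .
  qed
  have pern: "h (1 + real n + x) = h (1 + x)" if "x \<ge> 0" for n x
  proof (induction n)
    case (Suc n)
    have "h (1 + real (Suc n) + x) = h ((1 + real n + x) + 1)" by (simp add: algebra_simps)
    with Suc show ?case using per[of "1 + real n + x"] that by simp
  qed simp
  have seq: "filterlim (\<lambda>n. 1 + real n) at_top sequentially" by real_asymp
  have I1: "((\<lambda>s. wt_integral 1 (s + t) / wt_integral 1 s) \<longlongrightarrow> (128/125) powr t) at_top"
    by (rule wt_integral_ratio_tendsto[OF _ t wt_integral_1_recurrence]) (simp, assumption, real_asymp, simp)
  have I0: "((\<lambda>s. wt_integral 0 (s + t) / wt_integral 0 s) \<longlongrightarrow> 1 powr t) at_top"
    by (rule wt_integral_ratio_tendsto[OF _ t wt_integral_0_recurrence]) (simp, assumption, real_asymp, simp)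
  have "(\<lambda>n. (wt_integral 1 (1 + real n + t) / wt_integral 1 (1 + real n)) / (wt_integral 0 (1 + real n + t) / wt_integral 0 (1 + real n))
      / (Gamma_quotient (1 + real n + t) / Gamma_quotient (1 + real n))) \<longlonglongrightarrow> (128/125) powr t / 1 powr t / (128/125) powr t"
    using t by (intro tendsto_divide filterlim_compose[OF I1 seq] filterlim_compose[OF I0 seq] Gamma_quotient_ratio_tendsto) auto
  also have "(\<lambda>n. (wt_integral 1 (1 + real n + t) / wt_integral 1 (1 + real n)) / (wt_integral 0 (1 + real n + t) / wt_integral 0 (1 + real n))
      / (Gamma_quotient (1 + real n + t) / Gamma_quotient (1 + real n))) = (\<lambda>n. h (1 + real n + t) / h (1 + real n))"
    by (simp add: h_def mult_ac)
  also have "\<dots> = (\<lambda>n. h (1 + t) / h 1)"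
    using pern[of t] pern[of 0] t by simp
  finally have "h (1 + t) / h 1 = 1"
    by (simp add: LIMSEQ_const_iff)
  moreover have "h 1 = Gamma (4/5) * Gamma (6/5) / Gamma (3/2)"
  proof -
    have p: "Gamma (4/5) \<noteq> (0::real)" "Gamma (6/5) \<noteq> (0::real)"
      using Gamma_real_pos[of "4/5"] Gamma_real_pos[of "6/5"] by linarith+
    have "h 1 = 1 / Gamma_quotient 1" using pos[of 1] by (simp add: h_def wt_integrals_agree_at_1)
    then show ?thesis
      unfolding Gamma_quotient_1 [symmetric] using pos(3)[of 1] p by simp
  qed
  ultimately have "h (1 + t) = Gamma (4/5) * Gamma (6/5) / Gamma (3/2)"
    by (metis divide_eq_1_iff)
  then show ?thesis using pos[of "1 + t"] t by (simp add: h_def field_simps)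
qed

section \<open>Continuation to complex parameters\<close>

text \<open>
  Dividing by \<open>Gamma (3/2 - 4 * a)\<close> makes each term entire in \<open>a\<close>: the factor \<open>pochhammer\<close> of the
  lower parameter is absorbed by \<open>rGamma (3/2 - 4 * a + n)\<close>. The identity theorem can then be applied
  on the whole plane.
\<close>

definition regularised_term :: "nat \<Rightarrow> complex \<Rightarrow> complex" where
  "regularised_term n a = pochhammer a n * pochhammer (a + 1/2) n * rGamma (3/2 - 4 * a + of_nat n) / fact n * (1/5) ^ n"

definition regularised_F :: "complex \<Rightarrow> complex" where
  "regularised_F a = (\<Sum>n. regularised_term n a)"

lemma regularised_F_eq:
  assumes "3/2 - 4 * a \<notin> \<int>\<^sub>\<le>\<^sub>0"
  shows "regularised_F a = hypergeo_F a (a + 1/2) (3/2 - 4 * a) (1/5) * rGamma (3/2 - 4 * a)"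
proof -
  let ?T = "\<lambda>n. pochhammer a n * pochhammer (a + 1/2) n / (pochhammer (3/2 - 4 * a) n * pochhammer 1 n) * (1/5) ^ n"
  have "regularised_term n a = pochhammer a n * pochhammer (a + 1/2) n / (pochhammer (3/2 - 4 * a) n * pochhammer 1 n) * (1/5) ^ n * rGamma (3/2 - 4 * a)" for n
  proof -
    have "pochhammer (3/2 - 4 * a) n \<noteq> 0"
      using assms pochhammer_eq_0_imp_nonpos_Int by blast
    then show ?thesis
      unfolding regularised_term_def by (subst pochhammer_rGamma[of "3/2 - 4 * a" n]) (simp add: pochhammer_fact field_simps)
  qed
  then have "regularised_F a = (\<Sum>n. ?T n * rGamma (3/2 - 4 * a))"
    unfolding regularised_F_def by (simp only:)
  also have "\<dots> = (\<Sum>n. ?T n) * rGamma (3/2 - 4 * a)"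
    by (rule suminf_mult2[OF hypergeo_F_summable, symmetric]) (simp add: norm_divide)
  finally show ?thesis unfolding hypergeo_F_def .
qed

lemma regularised_term_holomorphic: "regularised_term n holomorphic_on A"
  unfolding regularised_term_def[abs_def] pochhammer_prod
  by (intro holomorphic_intros) auto

lemma regularised_term_Suc:
  assumes "3/2 - 4 * a + of_nat n \<noteq> 0"
  shows "regularised_term (Suc n) a = regularised_term n a * ((a + of_nat n) * (a + 1/2 + of_nat n) / ((3/2 - 4 * a + of_nat n) * of_nat (n + 1) * 5))"
proof -
  define g where "g = rGamma (3/2 - 4 * a + of_nat (Suc n))"
  have g: "rGamma (3/2 - 4 * a + of_nat n) = (3/2 - 4 * a + of_nat n) * g"
    using rGamma_plus1[of "3/2 - 4 * a + of_nat n"] by (simp add: g_def add_ac)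
  have cancel: "A * u * (B * v) * g / (m * f) * (1/5 * q) = A * B * (c * g) / f * q * (u * v / (c * m * 5))"
    if "c \<noteq> 0" for A B u v f q c m :: complex
    using that by (simp add: mult_ac)
  have "regularised_term (Suc n) a = pochhammer a n * (a + of_nat n) * (pochhammer (a + 1/2) n * (a + 1/2 + of_nat n)) * g
      / (of_nat (n + 1) * fact n) * (1/5 * (1/5) ^ n)"
    by (simp add: regularised_term_def g_def pochhammer_Suc)
  also note cancel[OF assms]
  finally show ?thesis by (simp only: regularised_term_def g)
qed

text \<open>
  The quotient of consecutive terms tends to \<open>1/5\<close>. What matters is that it is below \<open>1/2\<close> from an
  index on that depends on the bound \<open>R\<close> alone, which gives convergence uniformly on discs.
\<close>

lemma regularised_term_ratio_bound:
  assumes R: "norm a \<le> R" "1 \<le> R" and n: "real n \<ge> 40 * R"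
  shows "norm (regularised_term (Suc n) a) \<le> 1/2 * norm (regularised_term n a)"
proof -
  have d: "norm (3/2 - 4 * a + of_nat n) \<ge> 4/5 * real n"
  proof -
    have "norm (of_nat n :: complex) \<le> norm (3/2 - 4 * a + of_nat n) + norm (4 * a - 3/2)"
      using norm_triangle_ineq[of "3/2 - 4 * a + of_nat n" "4 * a - 3/2"] by simp
    moreover have "norm (4 * a - 3/2) \<le> 4 * norm a + 3/2"
      using norm_triangle_ineq4[of "4 * a" "3/2"] by (simp add: norm_mult)
    ultimately show ?thesis using R n by simp
  qed
  have n0: "real n > 0" using R n by linarith
  have "norm (a + of_nat n) \<le> norm a + real n" using norm_triangle_ineq[of a "of_nat n"] by simp
  then have u: "norm (a + of_nat n) \<le> 11/10 * real n" using R n by linarith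
  have "norm (a + 1/2 + of_nat n) \<le> norm a + 1/2 + real n"
    using norm_triangle_ineq[of "a + 1/2" "of_nat n"] norm_triangle_ineq[of a "1/2"] by simp
  then have v: "norm (a + 1/2 + of_nat n) \<le> 11/10 * real n" using R n by linarith
  have "norm ((a + of_nat n) * (a + 1/2 + of_nat n) / ((3/2 - 4 * a + of_nat n) * of_nat (n + 1) * 5))
    = norm (a + of_nat n) * norm (a + 1/2 + of_nat n) / (norm (3/2 - 4 * a + of_nat n) * real (n + 1) * 5)"
    by (simp only: norm_divide norm_mult norm_of_nat norm_numeral)
  also have "\<dots> \<le> (11/10 * real n) * (11/10 * real n) / (4/5 * real n * real n * 5)"
    using d u v n0 by (intro frac_le mult_mono mult_pos_pos mult_nonneg_nonneg) auto
  also have "\<dots> \<le> 1/2" using n0 by (simp add: field_simps)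
  finally have q: "norm ((a + of_nat n) * (a + 1/2 + of_nat n) / ((3/2 - 4 * a + of_nat n) * of_nat (n + 1) * 5)) \<le> 1/2" .
  have nz: "3/2 - 4 * a + of_nat n \<noteq> 0" using d n0 by auto
  have "norm (regularised_term (Suc n) a) = norm (regularised_term n a) *
      norm ((a + of_nat n) * (a + 1/2 + of_nat n) / ((3/2 - 4 * a + of_nat n) * of_nat (n + 1) * 5))"
    by (simp only: regularised_term_Suc[OF nz] norm_mult)
  also have "\<dots> \<le> norm (regularised_term n a) * (1/2)"
    by (rule mult_left_mono[OF q]) simp
  finally show ?thesis by simp
qed

lemma regularised_F_uniform_limit:
  "uniform_limit (cball z 1) (\<lambda>n a. \<Sum>k<n. regularised_term k a) regularised_F sequentially"
proof -
  define R where "R = norm z + 1"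
  have R: "1 \<le> R" "norm a \<le> R" if "a \<in> cball z 1" for a
    using that norm_triangle_ineq2[of a z] by (auto simp: R_def dist_norm norm_minus_commute)
  obtain N :: nat where N: "real N \<ge> 40 * R" using real_arch_simple by blast
  have "bounded (regularised_term N ` cball z 1)"
    by (intro compact_imp_bounded compact_continuous_image holomorphic_on_imp_continuous_on regularised_term_holomorphic compact_cball)
  then obtain C where C: "norm (regularised_term N a) \<le> C" if "a \<in> cball z 1" for a
    unfolding bounded_iff by blast
  have bound: "norm (regularised_term (N + k) a) \<le> C * (1/2) ^ k" if a: "a \<in> cball z 1" for k a
  proof (induction k)
    case 0
    show ?case using C[OF a] by simp
  next
    case (Suc k)
    have "norm (regularised_term (Suc (N + k)) a) \<le> 1/2 * norm (regularised_term (N + k) a)"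
      using R[OF a] N by (intro regularised_term_ratio_bound) auto
    with Suc show ?case by simp
  qed
  have "eventually (\<lambda>n. \<forall>a\<in>cball z 1. norm (regularised_term n a) \<le> C * (1/2) ^ (n - N)) sequentially"
    using eventually_ge_at_top[of N]
  proof eventually_elim
    case (elim n)
    then show ?case using bound[of _ "n - N"] by simp
  qed
  moreover have "summable (\<lambda>n. C * (1/2) ^ (n - N))"
    by (subst summable_iff_shift[of _ N, symmetric]) (auto intro!: summable_mult summable_geometric)
  ultimately show ?thesis
    unfolding regularised_F_def[abs_def] by (rule Weierstrass_m_test_ev)
qed

lemma regularised_F_holomorphic: "regularised_F holomorphic_on UNIV"
proof (rule holomorphic_uniform_sequence)
  show "(\<lambda>a. \<Sum>k<n. regularised_term k a) holomorphic_on UNIV" for n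
    by (intro holomorphic_intros regularised_term_holomorphic)
  show "\<exists>d. 0 < d \<and> cball x d \<subseteq> UNIV \<and> uniform_limit (cball x d) (\<lambda>n a. \<Sum>k<n. regularised_term k a) regularised_F sequentially" for x
    by (intro exI[of _ 1] conjI regularised_F_uniform_limit) auto
qed auto

lemma of_real_notin_nonpos_Ints: "x > 0 \<Longrightarrow> of_real x \<notin> (\<int>\<^sub>\<le>\<^sub>0 :: complex set)"
  by (auto elim!: nonpos_Ints_cases simp: complex_eq_iff)

definition closed_form :: "complex \<Rightarrow> complex" where
  "closed_form a = 5 powr (6 * a) * Gamma (4/5) * Gamma (6/5) /
      (2 powr (10 * a) * Gamma (3/2)) * rGamma (4/5 - 2 * a) * rGamma (6/5 - 2 * a)"

lemma closed_form_holomorphic: "closed_form holomorphic_on UNIV"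
proof -
  have "Gamma (3/2 :: complex) \<noteq> 0"
    using of_real_notin_nonpos_Ints[of "3/2"] by (simp add: Gamma_eq_zero_iff)
  then show ?thesis
    unfolding closed_form_def[abs_def] by (intro holomorphic_intros) auto
qed

text \<open>
  The segment \<open>a \<in> [-1, -1/2]\<close> corresponds to exponents \<open>s = - 2 * a\<close> between 1 and 2, which is all
  that the identity theorem needs.
\<close>

lemma regularised_F_eq_closed_form_real:
  assumes t: "t \<in> {0..1}"
  shows "regularised_F (of_real (- (1 + t) / 2)) = closed_form (of_real (- (1 + t) / 2))"
proof -
  define s where "s = 1 + t"
  have s: "s > 0" using t by (simp add: s_def)
  define a :: complex where "a = of_real (- s / 2)"
  have c: "3/2 - 4 * a = of_real (3/2 + 2 * s)" "4/5 - 2 * a = of_real (4/5 + s)" "6/5 - 2 * a = of_real (6/5 + s)"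
    by (simp_all add: a_def)
  have nz: "3/2 - 4 * a \<notin> \<int>\<^sub>\<le>\<^sub>0"
    unfolding c using s by (intro of_real_notin_nonpos_Ints) auto
  have "regularised_F a = of_real (wt_integral 1 s / wt_integral 0 s) * rGamma (3/2 - 4 * a)"
    using hypergeo_F_eq_quotient[OF s, folded a_def] by (simp only: regularised_F_eq[OF nz])
  also have "\<dots> = of_real (Gamma (4/5) * Gamma (6/5) / Gamma (3/2) * Gamma_quotient s * rGamma (3/2 + 2 * s))"
    unfolding c rGamma_complex_of_real wt_integral_quotient[OF t, folded s_def] by (rule of_real_mult [symmetric])
  also have "Gamma (4/5) * Gamma (6/5) / Gamma (3/2) * Gamma_quotient s * rGamma (3/2 + 2 * s) =
      Gamma (4/5) * Gamma (6/5) / Gamma (3/2) * (Gamma_quotient s * rGamma (3/2 + 2 * s))"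
    by simp
  also have "Gamma_quotient s * rGamma (3/2 + 2 * s) = 5 powr (- 3 * s) / 2 powr (- 5 * s) * rGamma (4/5 + s) * rGamma (6/5 + s)"
  proof -
    have G: "Gamma (3/2 + 2 * s) > 0" using s by (intro Gamma_real_pos) auto
    have pw: "(32/125) powr s = 5 powr (- 3 * s) / 2 powr (- 5 * s)"
    proof -
      have "(32/125::real) = 2 powr 5 / 5 powr 3" by simp
      then have "(32/125) powr s = 2 powr (5 * s) / 5 powr (3 * s)"
        by (simp only: powr_divide powr_powr)
      then show ?thesis by (simp add: powr_minus field_simps)
    qed
    show ?thesis unfolding Gamma_quotient_def pw rGamma_inverse_Gamma using G by (simp add: field_simps)
  qed
  finally have "regularised_F a = of_real (Gamma (4/5) * Gamma (6/5) / Gamma (3/2) * (5 powr (- 3 * s) / 2 powr (- 5 * s) * rGamma (4/5 + s) * rGamma (6/5 + s)))" .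
  also have "\<dots> = closed_form a"
  proof -
    have p: "(5::complex) powr (6 * a) = of_real (5 powr (- 3 * s))" "(2::complex) powr (10 * a) = of_real (2 powr (- 5 * s))"
      using powr_of_real[of 5 "- 3 * s"] powr_of_real[of 2 "- 5 * s"] by (simp_all add: a_def)
    have g: "Gamma (4/5 :: complex) = of_real (Gamma (4/5))" "Gamma (6/5 :: complex) = of_real (Gamma (6/5))"
        "Gamma (3/2 :: complex) = of_real (Gamma (3/2))"
      by (simp_all flip: Gamma_complex_of_real)
    show ?thesis unfolding closed_form_def c p g rGamma_complex_of_real by (simp add: mult_ac)
  qed
  finally show ?thesis by (simp only: a_def s_def)
qed

lemma regularised_F_eq_closed_form: "regularised_F a = closed_form a"
proof -
  define U :: "complex set" where "U = (\<lambda>t. of_real (- (1 + t) / 2)) ` {0..1::real}"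
  have U: "connected U"
    unfolding U_def by (intro connected_continuous_image continuous_intros) auto
  have el: "- 1/2 \<in> U" "- 1 \<in> U" by (auto simp: U_def intro!: image_eqI[of _ _ 0] image_eqI[of _ _ 1])
  have "- 1/2 \<noteq> (- 1 :: complex)" by (simp add: complex_eq_iff)
  with el U have islim: "(- 1/2) islimpt U" by (intro connected_imp_perfect) auto
  have "regularised_F a - closed_form a = 0"
  proof (rule analytic_continuation[of "\<lambda>a. regularised_F a - closed_form a" UNIV U "- 1/2"])
    show "(\<lambda>a. regularised_F a - closed_form a) holomorphic_on UNIV"
      by (intro holomorphic_intros regularised_F_holomorphic closed_form_holomorphic)
    show "regularised_F z - closed_form z = 0" if "z \<in> U" for z
      using that regularised_F_eq_closed_form_real by (auto simp: U_def simp del: of_real_divide of_real_minus of_real_add)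
  qed (use islim in auto)
  then show ?thesis by simp
qed

theorem mainTheorem10:
  fixes a :: complex
  assumes "3/2 - 4 * a \<notin> \<int>\<^sub>\<le>\<^sub>0"
  shows "hypergeo_F a (a + 1/2) (3/2 - 4 * a) (1/5) =
    5 powr (6 * a) * Gamma (4/5) * Gamma (6/5) * Gamma (3/2 - 4 * a) /
      (2 powr (10 * a) * Gamma (3/2)) * rGamma (4/5 - 2 * a) * rGamma (6/5 - 2 * a)"
proof -
  have "hypergeo_F a (a + 1/2) (3/2 - 4 * a) (1/5) * rGamma (3/2 - 4 * a) = closed_form a"
    using regularised_F_eq[OF assms] regularised_F_eq_closed_form by simp
  moreover have "rGamma (3/2 - 4 * a) * Gamma (3/2 - 4 * a) = 1"
    using assms by (simp add: rGamma_inverse_Gamma Gamma_eq_zero_iff)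
  ultimately have "hypergeo_F a (a + 1/2) (3/2 - 4 * a) (1/5) = closed_form a * Gamma (3/2 - 4 * a)"
    by (metis mult.assoc mult.right_neutral)
  then show ?thesis by (simp add: closed_form_def)
qed

end
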